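(* Let $P$ be an inhomogeneous $2\times 2$ zero-one matrix. Then there is a constant $c>0$ such that for every $n$, every $P$-free $n\times n$ zero-one matrix $A$ contains a homogeneous $cn\times cn$ submatrix.
   Context: A matrix is homogeneous if all of its entries are equal, and inhomogeneous otherwise. For an $n\times n$ matrix $A$ and sets $X,Y\subseteq[n]$, $A[X\times Y]$ denotes the submatrix formed by the rows in $X$ and the columns in $Y$ (in their original order); an $s\times t$ submatrix is one with $|X|=s$, $|Y|=t$. A $k\times \ell$ matrix $P$ is contained in $A$ (is a submatrix of $A$) if there are row indices $i_1<\dots<i_k$ and column indices $j_1<\dots<j_\ell$ with $A(i_a,j_b)=P(a,b)$ for all $a,b$; $A$ is $P$-free if it does not contain $P$. Floors and ceilings of quantities such as $cn$ are omitted. *)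

theory Defs
  imports Complex_Main "Jordan_Normal_Form.DL_Submatrix"
begin

definition zero_one_mat :: "nat mat \<Rightarrow> bool" where
  "zero_one_mat A \<longleftrightarrow> elements_mat A \<subseteq> {0, 1}"

definition homogeneous :: "'a mat \<Rightarrow> bool" where
  "homogeneous A \<longleftrightarrow> (\<forall>x \<in> elements_mat A. \<forall>y \<in> elements_mat A. x = y)"

text \<open>The increasing index sequences $i_1 < \dots < i_k$ and $j_1 < \dots < j_\ell$ are the
  functions \<open>r\<close> and \<open>s\<close>. Rows and columns are indexed from 0.\<close>

definition contains_mat :: "'a mat \<Rightarrow> 'a mat \<Rightarrow> bool" where
  "contains_mat A P \<longleftrightarrow>
     (\<exists>r s. strict_mono_on {..<dim_row P} r \<and> r ` {..<dim_row P} \<subseteq> {..<dim_row A} \<and>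
            strict_mono_on {..<dim_col P} s \<and> s ` {..<dim_col P} \<subseteq> {..<dim_col A} \<and>
            (\<forall>a < dim_row P. \<forall>b < dim_col P. A $$ (r a, s b) = P $$ (a, b)))"

abbreviation mat_free :: "'a mat \<Rightarrow> 'a mat \<Rightarrow> bool" where
  "mat_free P A \<equiv> \<not> contains_mat A P"

end

theory Submission
  imports Defs
begin

text \<open>
  Reversing the rows, transposing and complementing leave three patterns, with rows 00/11, 10/01
  and 11/10.

  If 00/11 is forbidden, every row above the middle one misses at most one of its ones, and every
  row below hits at most one of its zeros.

  If 10/01 is forbidden, take rows \<open>i < i'\<close> and split the columns into a left and a right half: the
  ones of \<open>i\<close> in the left half are ones of \<open>i'\<close>, or those of \<open>i'\<close> in the right half are ones of \<open>i\<close>.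
  Hence the upper rows are sparse on the left, or almost full on the right, unless there is a large
  homogeneous rectangle. For sparse rows, double counting of pairs of columns applies.

  If 11/10 is forbidden, every one at \<open>(i, j)\<close> spans a rectangle of ones: the ones to its right times
  the ones below it. If half of the columns are more than half full, some one has many ones in both
  directions. Otherwise the bipartite graph of the remaining columns behaves like a chordal graph
  with the rows as an elimination order: add the rows from top to bottom until a
  connected component contains a third of the columns. All later neighbours of this component are
  neighbours of its last column, so deleting the at most half of the rows adjacent to that column
  leaves a balanced separation.
\<close>

section \<open>Constant rectangles and forbidden patterns in Boolean arrays\<close>

definition constant_on_rect :: "('a \<Rightarrow> 'b \<Rightarrow> bool) \<Rightarrow> 'a set \<Rightarrow> 'b set \<Rightarrow> bool" where
  "constant_on_rect E X Y \<longleftrightarrow> (\<exists>v. \<forall>i\<in>X. \<forall>j\<in>Y. E i j = v)"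

text \<open>Bounds of the form \<open>n <= 32 * card X\<close> keep all sizes in the naturals. The
  factor 32 is common to all patterns and comes from the diagonal one, the others losing
  less.\<close>

definition large_rect :: "nat \<Rightarrow> (nat \<Rightarrow> nat \<Rightarrow> bool) \<Rightarrow> bool" where
  "large_rect n E \<longleftrightarrow> (\<exists>X Y. X \<subseteq> {..<n} \<and> Y \<subseteq> {..<n} \<and> n \<le> 32 * card X \<and> n \<le> 32 * card Y \<and>
     constant_on_rect E X Y)"

definition avoids :: "nat \<Rightarrow> (nat \<Rightarrow> nat \<Rightarrow> bool) \<Rightarrow> bool \<Rightarrow> bool \<Rightarrow> bool \<Rightarrow> bool \<Rightarrow> bool" where
  "avoids n E p q r s \<longleftrightarrow> (\<forall>i i' j j'. i < i' \<longrightarrow> i' < n \<longrightarrow> j < j' \<longrightarrow> j' < n \<longrightarrow>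
     \<not> (E i j = p \<and> E i j' = q \<and> E i' j = r \<and> E i' j' = s))"

definition forces_large_rect :: "bool \<Rightarrow> bool \<Rightarrow> bool \<Rightarrow> bool \<Rightarrow> bool" where
  "forces_large_rect p q r s \<longleftrightarrow> (\<forall>n E. avoids n E p q r s \<longrightarrow> large_rect n E)"

lemma avoidsD:
  assumes "avoids n E p q r s" "i < i'" "i' < n" "j < j'" "j' < n"
  shows "\<not> (E i j = p \<and> E i j' = q \<and> E i' j = r \<and> E i' j' = s)"
  using assms unfolding avoids_def by blast

lemma large_rectI:
  assumes "X \<subseteq> {..<n}" "Y \<subseteq> {..<n}" "n \<le> 32 * card X" "n \<le> 32 * card Y"
    and "\<And>i j. i \<in> X \<Longrightarrow> j \<in> Y \<Longrightarrow> E i j = v"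
  shows "large_rect n E"
proof -
  have "constant_on_rect E X Y"
    unfolding constant_on_rect_def using assms(5) by (intro exI[of _ v]) simp
  then show ?thesis
    using assms(1-4) unfolding large_rect_def by (intro exI[of _ X] exI[of _ Y]) simp
qed

lemma card_le_of_eq_Un:
  assumes "S = A \<union> B"
  shows "card S \<le> card A + card B"
  unfolding assms by (rule card_Un_le)

text \<open>A single cell suffices here. With these \<open>n\<close> settled, the rounding in
  \<open>n div 4\<close> and \<open>n div 8\<close> does no harm later.\<close>

lemma large_rect_small:
  assumes "n \<le> 32"
  shows "large_rect n E"
proof (cases "n = 0")
  case True
  then show ?thesis by (intro large_rectI[of "{}" _ "{}"]) auto
next
  case False
  then show ?thesis using assms by (intro large_rectI[of "{0}" _ "{0}" _ "E 0 0"]) auto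
qed

subsection \<open>Symmetries\<close>

text \<open>Since \<open>forces_large_rect\<close> speaks of all arrays, it can be applied to the
  negated one; the rectangle stays and its value flips. The next two lemmas do the same with the
  transposed and the row-reversed array.\<close>

lemma forces_large_rect_complement:
  assumes "forces_large_rect p q r s"
  shows "forces_large_rect (\<not> p) (\<not> q) (\<not> r) (\<not> s)"
  unfolding forces_large_rect_def
proof (intro allI impI)
  fix n E assume "avoids n E (\<not> p) (\<not> q) (\<not> r) (\<not> s)"
  then have "avoids n (\<lambda>i j. \<not> E i j) p q r s"
    unfolding avoids_def by blast
  then have "large_rect n (\<lambda>i j. \<not> E i j)"
    using assms unfolding forces_large_rect_def by blast
  then obtain X Y v where "X \<subseteq> {..<n}" "Y \<subseteq> {..<n}" "n \<le> 32 * card X" "n \<le> 32 * card Y"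
    "\<forall>i\<in>X. \<forall>j\<in>Y. (\<not> E i j) = v"
    unfolding large_rect_def constant_on_rect_def by blast
  then show "large_rect n E"
    by (intro large_rectI[of X _ Y _ "\<not> v"]) auto
qed

lemma forces_large_rect_transpose:
  assumes "forces_large_rect p q r s"
  shows "forces_large_rect p r q s"
  unfolding forces_large_rect_def
proof (intro allI impI)
  fix n E assume "avoids n E p r q s"
  then have "avoids n (\<lambda>i j. E j i) p q r s"
    unfolding avoids_def by blast
  then have "large_rect n (\<lambda>i j. E j i)"
    using assms unfolding forces_large_rect_def by blast
  then obtain X Y v where "X \<subseteq> {..<n}" "Y \<subseteq> {..<n}" "n \<le> 32 * card X" "n \<le> 32 * card Y"
    "\<forall>i\<in>X. \<forall>j\<in>Y. E j i = v"
    unfolding large_rect_def constant_on_rect_def by blast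
  then show "large_rect n E"
    by (intro large_rectI[of Y _ X _ v]) auto
qed

lemma forces_large_rect_flip_rows:
  assumes "forces_large_rect p q r s"
  shows "forces_large_rect r s p q"
  unfolding forces_large_rect_def
proof (intro allI impI)
  fix n E assume av: "avoids n E r s p q"
  \<comment> \<open>Reflection of the rows; despite truncated subtraction it is injective on indices
    below \<open>n\<close>.\<close>
  define h where "h i = n - 1 - i" for i :: nat
  have "avoids n (\<lambda>i j. E (h i) j) p q r s"
    unfolding avoids_def
  proof (intro allI impI)
    fix i i' j j' assume *: "i < i'" "i' < n" "j < j'" "j' < n"
    have "h i' < h i" "h i < n" using * unfolding h_def by auto
    from avoidsD[OF av this *(3,4)]
    show "\<not> (E (h i) j = p \<and> E (h i) j' = q \<and> E (h i') j = r \<and> E (h i') j' = s)" by blast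
  qed
  then have "large_rect n (\<lambda>i j. E (h i) j)"
    using assms unfolding forces_large_rect_def by blast
  then obtain X Y v where XY: "X \<subseteq> {..<n}" "Y \<subseteq> {..<n}" "n \<le> 32 * card X" "n \<le> 32 * card Y"
    "\<forall>i\<in>X. \<forall>j\<in>Y. E (h i) j = v"
    unfolding large_rect_def constant_on_rect_def by blast
  have "inj_on h X"
  proof (rule inj_onI)
    fix x y assume "x \<in> X" "y \<in> X" "h x = h y"
    moreover have "x < n" "y < n" using calculation XY(1) by auto
    ultimately show "x = y" unfolding h_def by linarith
  qed
  then have "card (h ` X) = card X" by (rule card_image)
  moreover have "h ` X \<subseteq> {..<n}" using XY(1) unfolding h_def by auto
  ultimately show "large_rect n E"
    using XY by (intro large_rectI[of "h ` X" _ Y _ v]) auto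
qed

subsection \<open>Constant rows\<close>

text \<open>Union bound: each \<open>i\<close> in \<open>X\<close> spoils at most one element of
  \<open>S\<close>.\<close>

lemma card_few_exceptions:
  assumes "finite S" "finite X" "\<And>i. i \<in> X \<Longrightarrow> card {j \<in> S. \<not> Q i j} \<le> 1"
  shows "card S \<le> card {j \<in> S. \<forall>i\<in>X. Q i j} + card X"
proof -
  have "S = {j \<in> S. \<forall>i\<in>X. Q i j} \<union> (\<Union>i\<in>X. {j \<in> S. \<not> Q i j})" by auto
  then have "card S \<le> card {j \<in> S. \<forall>i\<in>X. Q i j} + card (\<Union>i\<in>X. {j \<in> S. \<not> Q i j})"
    by (rule card_le_of_eq_Un)
  moreover have "card (\<Union>i\<in>X. {j \<in> S. \<not> Q i j}) \<le> (\<Sum>i\<in>X. card {j \<in> S. \<not> Q i j})"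
    by (rule card_UN_le) fact
  moreover have "\<dots> \<le> (\<Sum>i\<in>X. 1)" by (rule sum_mono) (rule assms(3))
  ultimately show ?thesis by simp
qed

lemma card_le_one_nat:
  fixes S :: "nat set"
  assumes "\<And>j j'. j \<in> S \<Longrightarrow> j' \<in> S \<Longrightarrow> j < j' \<Longrightarrow> False"
  shows "card S \<le> 1"
proof -
  have "\<exists>a. S \<subseteq> {a}"
    using assms by (metis linorder_neqE_nat singletonI subsetI)
  then obtain a where "S \<subseteq> {a}" by blast
  then show ?thesis using card_mono[of "{a}" S] by simp
qed

lemma forces_constant_rows: "forces_large_rect False False True True"
  unfolding forces_large_rect_def
proof (intro allI impI)
  fix n E assume av: "avoids n E False False True True"
  show "large_rect n E"
  proof (cases "n \<le> 32")
    case True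
    then show ?thesis by (rule large_rect_small)
  next
    case n: False
    \<comment> \<open>The more frequent value of row \<open>k\<close> fills at least
      \<open>2 * k\<close> columns. The union bound over \<open>k\<close> rows costs
      \<open>k\<close> of them, so at least \<open>k\<close> survive.\<close>
    define k where "k = n div 4"
    have k: "n \<le> 8 * k" "4 * k \<le> n" "k < n - k" using n unfolding k_def by auto
    define S where "S v = {j \<in> {..<n}. E k j = v}" for v
    have "{..<n} = S True \<union> S False" unfolding S_def by auto
    then have "card {..<n} \<le> card (S True) + card (S False)" by (rule card_le_of_eq_Un)
    then have "n \<le> card (S True) + card (S False)" by simp
    then have "n \<le> 2 * card (S True) \<or> n \<le> 2 * card (S False)" by auto
    then consider "n \<le> 2 * card (S True)" | "n \<le> 2 * card (S False)" by blast
    then show ?thesis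
    proof cases
      case 1
      define Y where "Y = {j \<in> S True. \<forall>i\<in>{..<k}. E i j}"
      have "card {j \<in> S True. \<not> E i j} \<le> 1" if "i \<in> {..<k}" for i
      proof (rule card_le_one_nat)
        fix j j' assume "j \<in> {j \<in> S True. \<not> E i j}" "j' \<in> {j \<in> S True. \<not> E i j}" "j < j'"
        then show False using avoidsD[OF av, of i k j j'] that k unfolding S_def by auto
      qed
      from card_few_exceptions[of "S True" "{..<k}" E, OF _ _ this]
      have "card (S True) \<le> card Y + k" unfolding Y_def by (simp add: S_def)
      then show ?thesis using k 1
        by (intro large_rectI[of "{..<k}" _ Y _ True]) (auto simp: Y_def S_def)
    next
      case 2
      define Y where "Y = {j \<in> S False. \<forall>i\<in>{n-k..<n}. \<not> E i j}"
      \<comment> \<open>The double negation is what \<open>card_few_exceptions\<close> yields when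
        its \<open>Q\<close> is the negation of \<open>E\<close>.\<close>
      have "card {j \<in> S False. \<not> \<not> E i j} \<le> 1" if "i \<in> {n-k..<n}" for i
      proof (rule card_le_one_nat)
        fix j j' assume "j \<in> {j \<in> S False. \<not> \<not> E i j}" "j' \<in> {j \<in> S False. \<not> \<not> E i j}" "j < j'"
        then show False using avoidsD[OF av, of k i j j'] that k unfolding S_def by auto
      qed
      from card_few_exceptions[of "S False" "{n-k..<n}" "\<lambda>i j. \<not> E i j", OF _ _ this]
      have "card (S False) \<le> card Y + k" using k unfolding Y_def by (simp add: S_def)
      then show ?thesis using k 2
        by (intro large_rectI[of "{n-k..<n}" _ Y _ False]) (auto simp: Y_def S_def)
    qed
  qed
qed

subsection \<open>Diagonal patterns\<close>

text \<open>If \<open>j\<close> has a one in row \<open>a j\<close> and \<open>j'\<close> has a one in row \<open>b j'\<close>, then \<open>a j\<close> hits \<open>j'\<close> or \<open>b j'\<close> hits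
  \<open>j\<close>. Sparsity of the rows leaves room for few such pairs.\<close>

lemma empty_columns_of_sparse:
  fixes E :: "'a \<Rightarrow> 'b \<Rightarrow> bool"
  assumes fin: "finite I1" "finite I2" "finite J1" "finite J2"
    and cross: "\<And>i i' j j'. i \<in> I1 \<Longrightarrow> i' \<in> I2 \<Longrightarrow> j \<in> J1 \<Longrightarrow> j' \<in> J2 \<Longrightarrow> E i j \<Longrightarrow> E i' j' \<Longrightarrow>
        E i j' \<or> E i' j"
    and deg1: "\<And>i. i \<in> I1 \<Longrightarrow> card {j \<in> J2. E i j} \<le> d"
    and deg2: "\<And>i. i \<in> I2 \<Longrightarrow> card {j \<in> J1. E i j} \<le> d"
  shows "card J1 \<le> card {j \<in> J1. \<forall>i\<in>I1. \<not> E i j} + 2 * d \<or>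
    card J2 \<le> card {j \<in> J2. \<forall>i\<in>I2. \<not> E i j} + 2 * d"
proof -
  define K1 where "K1 = {j \<in> J1. \<exists>i\<in>I1. E i j}"
  define K2 where "K2 = {j \<in> J2. \<exists>i\<in>I2. E i j}"
  have finK: "finite K1" "finite K2" unfolding K1_def K2_def using fin by auto
  obtain a where a: "\<And>j. j \<in> K1 \<Longrightarrow> a j \<in> I1 \<and> E (a j) j"
  proof -
    have "\<forall>j\<in>K1. \<exists>i. i \<in> I1 \<and> E i j" unfolding K1_def by blast
    from bchoice[OF this] show ?thesis using that by blast
  qed
  obtain b where b: "\<And>j. j \<in> K2 \<Longrightarrow> b j \<in> I2 \<and> E (b j) j"
  proof -
    have "\<forall>j\<in>K2. \<exists>i. i \<in> I2 \<and> E i j" unfolding K2_def by blast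
    from bchoice[OF this] show ?thesis using that by blast
  qed
  \<comment> \<open>Each pair is charged to the row \<open>a j\<close> hitting \<open>j'\<close> or
    to the row \<open>b j'\<close> hitting \<open>j\<close>. Every chosen row is charged at most
    \<open>d\<close> times per column that chose it.\<close>
  have "K1 \<times> K2 \<subseteq> (SIGMA j:K1. {j' \<in> J2. E (a j) j'}) \<union> prod.swap ` (SIGMA j':K2. {j \<in> J1. E (b j') j})"
  proof
    fix x assume "x \<in> K1 \<times> K2"
    then obtain j j' where x: "x = (j, j')" "j \<in> K1" "j' \<in> K2" by auto
    have "j \<in> J1" "j' \<in> J2" using x unfolding K1_def K2_def by auto
    with cross[of "a j" "b j'" j j'] a[OF x(2)] b[OF x(3)]
    have "E (a j) j' \<or> E (b j') j" by blast
    with x \<open>j \<in> J1\<close> \<open>j' \<in> J2\<close>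
    show "x \<in> (SIGMA j:K1. {j' \<in> J2. E (a j) j'}) \<union> prod.swap ` (SIGMA j':K2. {j \<in> J1. E (b j') j})"
      by (auto simp: image_iff)
  qed
  then have "card (K1 \<times> K2) \<le> card ((SIGMA j:K1. {j' \<in> J2. E (a j) j'}) \<union>
      prod.swap ` (SIGMA j':K2. {j \<in> J1. E (b j') j}))"
    using fin finK by (intro card_mono) auto
  also have "\<dots> \<le> card (SIGMA j:K1. {j' \<in> J2. E (a j) j'}) +
      card (prod.swap ` (SIGMA j':K2. {j \<in> J1. E (b j') j}))"
    by (rule card_Un_le)
  also have "\<dots> \<le> card (SIGMA j:K1. {j' \<in> J2. E (a j) j'}) + card (SIGMA j':K2. {j \<in> J1. E (b j') j})"
    using fin finK by (intro add_left_mono card_image_le) auto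
  also have "\<dots> = (\<Sum>j\<in>K1. card {j' \<in> J2. E (a j) j'}) + (\<Sum>j'\<in>K2. card {j \<in> J1. E (b j') j})"
    using fin finK by (simp add: card_SigmaI)
  also have "\<dots> \<le> card K1 * d + card K2 * d"
    using sum_bounded_above[of K1 "\<lambda>j. card {j' \<in> J2. E (a j) j'}" d]
      sum_bounded_above[of K2 "\<lambda>j'. card {j \<in> J1. E (b j') j}" d] a b deg1 deg2
    by (intro add_mono) auto
  finally have le: "card K1 * card K2 \<le> card K1 * d + card K2 * d" by (simp add: card_cartesian_product)
  \<comment> \<open>If both factors exceeded \<open>2 * d\<close>, half of the product would exceed
    each summand of the bound \<open>le\<close>.\<close>
  have "card K1 \<le> 2 * d \<or> card K2 \<le> 2 * d"
  proof (rule ccontr)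
    assume "\<not> ?thesis"
    then have "2 * d + 1 \<le> card K1" "2 * d + 1 \<le> card K2" by auto
    then obtain x y where "card K1 = 2 * d + 1 + x" "card K2 = 2 * d + 1 + y"
      unfolding le_iff_add by blast
    with le show False by (simp add: algebra_simps)
  qed
  moreover have "J1 = {j \<in> J1. \<forall>i\<in>I1. \<not> E i j} \<union> K1" "J2 = {j \<in> J2. \<forall>i\<in>I2. \<not> E i j} \<union> K2"
    unfolding K1_def K2_def by auto
  then have "card J1 \<le> card {j \<in> J1. \<forall>i\<in>I1. \<not> E i j} + card K1"
    "card J2 \<le> card {j \<in> J2. \<forall>i\<in>I2. \<not> E i j} + card K2"
    by (blast intro: card_le_of_eq_Un)+
  ultimately show ?thesis by linarith
qed

text \<open>\<open>S1\<close> collects the least elements, moving the minimum of the rest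
  \<open>k\<close> times. It serves to place one block of rows entirely above another.\<close>

lemma split_initial_segment:
  fixes S :: "nat set"
  assumes "finite S" "k + l \<le> card S"
  obtains S1 S2 where "S1 \<subseteq> S" "S2 \<subseteq> S" "card S1 = k" "l \<le> card S2" "\<And>x y. x \<in> S1 \<Longrightarrow> y \<in> S2 \<Longrightarrow> x < y"
proof -
  have "\<exists>S1\<subseteq>S. card S1 = k \<and> (\<forall>x\<in>S1. \<forall>y\<in>S-S1. x < y)" if "k \<le> card S" for k
    using that
  proof (induction k)
    case 0
    show ?case by (rule exI[of _ "{}"]) auto
  next
    case (Suc k)
    then obtain S1 where S1: "S1 \<subseteq> S" "card S1 = k" "\<forall>x\<in>S1. \<forall>y\<in>S-S1. x < y" by auto
    have "S - S1 \<noteq> {}" using S1 Suc.prems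
      by (metis Diff_eq_empty_iff card_mono not_less_eq_eq assms(1) finite_subset)
    define m where "m = Min (S - S1)"
    have m: "m \<in> S - S1" "\<And>y. y \<in> S - S1 \<Longrightarrow> m \<le> y"
      unfolding m_def using assms(1) \<open>S - S1 \<noteq> {}\<close> by (auto intro!: Min_in simp del: Diff_iff)
    have "card (insert m S1) = Suc k"
      using m(1) S1 assms(1) by (simp add: finite_subset)
    moreover have "\<forall>x\<in>insert m S1. \<forall>y\<in>S - insert m S1. x < y"
      using S1(3) m by (auto simp: order_less_le)
    ultimately show ?case using m(1) S1(1) by (intro exI[of _ "insert m S1"]) auto
  qed
  then obtain S1 where S1: "S1\<subseteq>S" "card S1 = k" "\<forall>x\<in>S1. \<forall>y\<in>S-S1. x < y"
    using assms(2) by (metis add_leD1)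
  moreover have "l \<le> card (S - S1)"
    using S1 assms by (simp add: card_Diff_subset finite_subset)
  ultimately show ?thesis using that[of S1 "S - S1"] by blast
qed

lemma forces_diagonal: "forces_large_rect True False False True"
  unfolding forces_large_rect_def
proof (intro allI impI)
  fix n E assume av: "avoids n E True False False True"
  \<comment> \<open>The only form in which the pattern is used: two ones in descending diagonal
    position force a one at another corner of their rectangle.\<close>
  have cross: "E i j' \<or> E i' j" if "i < i'" "i' < n" "j < j'" "j' < n" "E i j" "E i' j'" for i i' j j'
    using avoidsD[OF av that(1-4)] that(5,6) by blast
  show "large_rect n E"
  proof (cases "n \<le> 32")
    case True
    then show ?thesis by (rule large_rect_small)
  next
    case n: False
    define k where "k = n div 8"
    \<comment> \<open>More than \<open>d\<close> columns are enough for a large rectangle, while a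
      loss of \<open>2 * d\<close> out of \<open>2 * k\<close> columns still leaves
      \<open>k\<close>.\<close>
    define d where "d = k div 2"
    have k: "n \<le> 16 * k" "8 * k \<le> n" "k \<le> 2 * (d + 1)" "2 * d \<le> k" using n unfolding k_def d_def by auto
    define N where "N i v J = {j \<in> J. E i j = v}" for i v and J :: "nat set"
    have finN: "finite (N i v J)" if "finite J" for i v J using that unfolding N_def by simp
    show ?thesis
    proof (cases "\<exists>i<4*k. d < card (N i True {..<4*k}) \<and> d < card (N i False {4*k..<8*k})")
      case True
      then obtain i where i: "i < 4*k" "d < card (N i True {..<4*k})" "d < card (N i False {4*k..<8*k})"
        by blast
      \<comment> \<open>Row \<open>i\<close> has many ones on the left and many zeros on the right.
        By \<open>cross\<close>, each lower row is full on those ones or empty on those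
        zeros.\<close>
      define A where "A = {i' \<in> {4*k..<8*k}. \<forall>j\<in>N i True {..<4*k}. E i' j}"
      define B where "B = {i' \<in> {4*k..<8*k}. \<forall>j\<in>N i False {4*k..<8*k}. \<not> E i' j}"
      have "{4*k..<8*k} \<subseteq> A \<union> B"
      proof
        fix i' assume i': "i' \<in> {4*k..<8*k}"
        show "i' \<in> A \<union> B"
        proof (rule ccontr)
          assume "i' \<notin> A \<union> B"
          then obtain j j' where j: "j \<in> N i True {..<4*k}" "\<not> E i' j"
            and j': "j' \<in> N i False {4*k..<8*k}" "E i' j'"
            using i' unfolding A_def B_def by blast
          have "E i j' \<or> E i' j"
            using i' i(1) k(2) j j' by (intro cross) (auto simp: N_def)
          then show False using j j' by (simp add: N_def)
        qed
      qed
      then have "card {4*k..<8*k} \<le> card (A \<union> B)"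
        by (rule card_mono[rotated]) (auto simp: A_def B_def)
      also have "\<dots> \<le> card A + card B" by (rule card_Un_le)
      finally have "2 * k \<le> card A \<or> 2 * k \<le> card B" by auto
      then consider "2 * k \<le> card A" | "2 * k \<le> card B" by blast
      then show ?thesis
      proof cases
        case 1
        then show ?thesis using i k
          by (intro large_rectI[of A _ "N i True {..<4*k}" _ True]) (auto simp: A_def N_def)
      next
        case 2
        then show ?thesis using i k
          by (intro large_rectI[of B _ "N i False {4*k..<8*k}" _ False]) (auto simp: B_def N_def)
      qed
    next
      case False
      \<comment> \<open>Now every upper row is sparse on the left or almost full on the right, and
        one kind accounts for half of these rows.\<close>
      define A where "A = {i. i < 4*k \<and> card (N i True {..<4*k}) \<le> d}"
      define B where "B = {i. i < 4*k \<and> card (N i False {4*k..<8*k}) \<le> d}"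
      have "{..<4*k} \<subseteq> A \<union> B"
      proof
        fix i assume "i \<in> {..<4*k}"
        then have "i < 4 * k" by simp
        moreover from this False
        have "\<not> (d < card (N i True {..<4*k}) \<and> d < card (N i False {4*k..<8*k}))" by blast
        ultimately show "i \<in> A \<union> B" unfolding A_def B_def by auto
      qed
      then have "card {..<4*k} \<le> card (A \<union> B)"
        by (rule card_mono[rotated]) (auto simp: A_def B_def)
      also have "\<dots> \<le> card A + card B" by (rule card_Un_le)
      finally have "2 * k \<le> card A \<or> 2 * k \<le> card B" by auto
      then consider "2 * k \<le> card A" | "2 * k \<le> card B" by blast
      then show ?thesis
      proof cases
        case 1
        then have "k + k \<le> card A" by simp
        moreover have "finite A" unfolding A_def by simp
        ultimately obtain I1 I2 where I: "I1 \<subseteq> A" "I2 \<subseteq> A" "card I1 = k" "k \<le> card I2"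
          "\<And>x y. x \<in> I1 \<Longrightarrow> y \<in> I2 \<Longrightarrow> x < y"
          using split_initial_segment[of A k k] by blast
        have sub: "I1 \<subseteq> {..<n}" "I2 \<subseteq> {..<n}" using I(1,2) k unfolding A_def by force+
        define J1 where "J1 = {..<2*k}"
        define J2 where "J2 = {2*k..<4*k}"
        have deg: "card {j \<in> J. E i j} \<le> d" if "i \<in> A" "J \<subseteq> {..<4*k}" for i J
        proof -
          have "card {j \<in> J. E i j} \<le> card (N i True {..<4*k})"
            using that(2) by (intro card_mono finN) (auto simp: N_def)
          then show ?thesis using that(1) unfolding A_def by simp
        qed
        have "card J1 \<le> card {j \<in> J1. \<forall>i\<in>I1. \<not> E i j} + 2 * d \<or>
          card J2 \<le> card {j \<in> J2. \<forall>i\<in>I2. \<not> E i j} + 2 * d"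
        proof (rule empty_columns_of_sparse)
          show "E i j' \<or> E i' j"
            if "i \<in> I1" "i' \<in> I2" "j \<in> J1" "j' \<in> J2" "E i j" "E i' j'" for i i' j j'
            using that I(5)[of i i'] sub k by (intro cross) (auto simp: J1_def J2_def)
          show "card {j \<in> J2. E i j} \<le> d" if "i \<in> I1" for i
            using that I(1) by (intro deg) (auto simp: J2_def)
          show "card {j \<in> J1. E i j} \<le> d" if "i \<in> I2" for i
            using that I(2) by (intro deg) (auto simp: J1_def)
          show "finite I1" "finite I2" using sub by (auto intro: finite_subset)
        qed (auto simp: J1_def J2_def)
        then show ?thesis
        proof
          assume "card J1 \<le> card {j \<in> J1. \<forall>i\<in>I1. \<not> E i j} + 2 * d"
          then show ?thesis using I k sub
            by (intro large_rectI[of I1 _ "{j \<in> J1. \<forall>i\<in>I1. \<not> E i j}" _ False]) (auto simp: J1_def)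
        next
          assume "card J2 \<le> card {j \<in> J2. \<forall>i\<in>I2. \<not> E i j} + 2 * d"
          then show ?thesis using I k sub
            by (intro large_rectI[of I2 _ "{j \<in> J2. \<forall>i\<in>I2. \<not> E i j}" _ False]) (auto simp: J2_def)
        qed
      next
        case 2
        then have "k + k \<le> card B" by simp
        moreover have "finite B" unfolding B_def by simp
        ultimately obtain I1 I2 where I: "I1 \<subseteq> B" "I2 \<subseteq> B" "card I1 = k" "k \<le> card I2"
          "\<And>x y. x \<in> I1 \<Longrightarrow> y \<in> I2 \<Longrightarrow> x < y"
          using split_initial_segment[of B k k] by blast
        have sub: "I1 \<subseteq> {..<n}" "I2 \<subseteq> {..<n}" using I(1,2) k unfolding B_def by force+
        \<comment> \<open>For zeros the crossing condition holds along the other diagonal, so the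
          upper block of rows is paired with the right block of columns.\<close>
        define J1 where "J1 = {6*k..<8*k}"
        define J2 where "J2 = {4*k..<6*k}"
        have deg: "card {j \<in> J. \<not> E i j} \<le> d" if "i \<in> B" "J \<subseteq> {4*k..<8*k}" for i J
        proof -
          have "card {j \<in> J. \<not> E i j} \<le> card (N i False {4*k..<8*k})"
            using that(2) by (intro card_mono finN) (auto simp: N_def)
          then show ?thesis using that(1) unfolding B_def by simp
        qed
        have "card J1 \<le> card {j \<in> J1. \<forall>i\<in>I1. \<not> \<not> E i j} + 2 * d \<or>
          card J2 \<le> card {j \<in> J2. \<forall>i\<in>I2. \<not> \<not> E i j} + 2 * d"
        proof (rule empty_columns_of_sparse)
          show "\<not> E i j' \<or> \<not> E i' j"
            if "i \<in> I1" "i' \<in> I2" "j \<in> J1" "j' \<in> J2" "\<not> E i j" "\<not> E i' j'" for i i' j j'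
            using that I(5)[of i i'] sub k cross[of i i' j' j] by (auto simp: J1_def J2_def)
          show "card {j \<in> J2. \<not> E i j} \<le> d" if "i \<in> I1" for i
            using that I(1) by (intro deg) (auto simp: J2_def)
          show "card {j \<in> J1. \<not> E i j} \<le> d" if "i \<in> I2" for i
            using that I(2) by (intro deg) (auto simp: J1_def)
          show "finite I1" "finite I2" using sub by (auto intro: finite_subset)
        qed (auto simp: J1_def J2_def)
        then show ?thesis
        proof
          assume "card J1 \<le> card {j \<in> J1. \<forall>i\<in>I1. \<not> \<not> E i j} + 2 * d"
          then show ?thesis using I k sub
            by (intro large_rectI[of I1 _ "{j \<in> J1. \<forall>i\<in>I1. \<not> \<not> E i j}" _ True]) (auto simp: J1_def)
        next
          assume "card J2 \<le> card {j \<in> J2. \<forall>i\<in>I2. \<not> \<not> E i j} + 2 * d"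
          then show ?thesis using I k sub
            by (intro large_rectI[of I2 _ "{j \<in> J2. \<forall>i\<in>I2. \<not> \<not> E i j}" _ True]) (auto simp: J2_def)
        qed
      qed
    qed
  qed
qed

subsection \<open>Three equal entries\<close>

text \<open>The pattern 11/10 has the shape of a capital Gamma; these are the Gamma-free matrices
  known from totally balanced matrices. The sets \<open>R\<close> and \<open>C\<close> allow a
  restriction to sparse or dense columns.\<close>

definition gamma_free :: "nat set \<Rightarrow> nat set \<Rightarrow> (nat \<Rightarrow> nat \<Rightarrow> bool) \<Rightarrow> bool" where
  "gamma_free R C E \<longleftrightarrow> (\<forall>i\<in>R. \<forall>i'\<in>R. \<forall>j\<in>C. \<forall>j'\<in>C. i < i' \<longrightarrow> j < j' \<longrightarrow>
     E i j \<longrightarrow> E i j' \<longrightarrow> E i' j \<longrightarrow> E i' j')"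

text \<open>Weak inequalities are harmless: if the rows or the columns coincide, the conclusion is
  one of the assumptions.\<close>

lemma gamma_freeD:
  assumes "gamma_free R C E" "i \<in> R" "i' \<in> R" "j \<in> C" "j' \<in> C" "i \<le> i'" "j \<le> j'"
    "E i j" "E i j'" "E i' j"
  shows "E i' j'"
  using assms unfolding gamma_free_def by (cases "i = i'"; cases "j = j'") auto

text \<open>Add the fibres one by one. Each contributes less than a third of \<open>N\<close>, so
  the total cannot jump from below one third to above two thirds.\<close>

lemma balanced_fibres:
  assumes "finite V0" "finite C"
    and "\<And>v. v \<in> V0 \<Longrightarrow> 3 * card {j \<in> C. f j = v} < N"
    and "N \<le> 3 * card {j \<in> C. f j \<in> V0}" "0 < N"
  shows "\<exists>V\<subseteq>V0. N \<le> 3 * card {j \<in> C. f j \<in> V} \<and> 3 * card {j \<in> C. f j \<in> V} \<le> 2 * N"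
  using assms(1,3,4)
proof (induction V0)
  case empty
  then show ?case using \<open>0 < N\<close> by simp
next
  case (insert v V0)
  show ?case
  proof (cases "N \<le> 3 * card {j \<in> C. f j \<in> V0}")
    case True
    with insert obtain V where "V \<subseteq> V0" "N \<le> 3 * card {j \<in> C. f j \<in> V}"
      "3 * card {j \<in> C. f j \<in> V} \<le> 2 * N"
      by auto
    then show ?thesis by blast
  next
    case False
    have "{j \<in> C. f j \<in> insert v V0} = {j \<in> C. f j = v} \<union> {j \<in> C. f j \<in> V0}" by auto
    then have "card {j \<in> C. f j \<in> insert v V0} \<le> card {j \<in> C. f j = v} + card {j \<in> C. f j \<in> V0}"
      by (rule card_le_of_eq_Un)
    moreover have "3 * card {j \<in> C. f j = v} < N" using insert.prems by simp
    ultimately have "3 * card {j \<in> C. f j \<in> insert v V0} \<le> 2 * N" using False by linarith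
    then show ?thesis using insert.prems by blast
  qed
qed

text \<open>A row outside \<open>Q\<close> that meets \<open>U\<close> is empty on
  \<open>C - U\<close>, and any other row outside \<open>Q\<close> is empty on \<open>U\<close>. One
  kind makes up a quarter of \<open>R\<close>, and both column sets contain a third of
  \<open>C\<close>.\<close>

lemma empty_rect_of_separation:
  assumes "finite R" "finite C" "U \<subseteq> C" "card C \<le> 3 * card U" "3 * card U \<le> 2 * card C"
    and "Q \<subseteq> R" "2 * card Q \<le> card R"
    and sep: "\<And>i j j'. i \<in> R - Q \<Longrightarrow> j \<in> U \<Longrightarrow> j' \<in> C - U \<Longrightarrow> E i j \<Longrightarrow> E i j' \<Longrightarrow> False"
  shows "\<exists>X Y. X \<subseteq> R \<and> Y \<subseteq> C \<and> card R \<le> 4 * card X \<and> card C \<le> 3 * card Y \<and>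
    (\<forall>i\<in>X. \<forall>j\<in>Y. \<not> E i j)"
proof -
  define A where "A = {i \<in> R - Q. \<exists>j\<in>U. E i j}"
  define B where "B = {i \<in> R - Q. \<forall>j\<in>U. \<not> E i j}"
  have fin: "finite A" "finite B" "finite U" "finite Q"
    using assms(1,2,3,6) unfolding A_def B_def by (auto intro: finite_subset)
  have "R - Q = A \<union> B" unfolding A_def B_def by auto
  then have "card (R - Q) \<le> card A + card B" by (rule card_le_of_eq_Un)
  then have "card R \<le> 2 * (card A + card B)"
    using assms(1,6,7) fin by (simp add: card_Diff_subset)
  then have "card R \<le> 4 * card A \<or> card R \<le> 4 * card B" by auto
  then consider "card R \<le> 4 * card A" | "card R \<le> 4 * card B" by blast
  then show ?thesis
  proof cases
    case 1
    moreover have "card C \<le> 3 * card (C - U)"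
      using assms fin by (simp add: card_Diff_subset)
    ultimately show ?thesis using sep
      by (intro exI[of _ A] exI[of _ "C - U"]) (auto simp: A_def)
  next
    case 2
    then show ?thesis using assms(3,4)
      by (intro exI[of _ B] exI[of _ U]) (auto simp: B_def)
  qed
qed

text \<open>\<open>f j\<close> is the last column of the connected component of column \<open>j\<close> in the bipartite graph with the
  rows \<open>i < s\<close> and all columns. The second clause is the elimination property: a later row that
  meets a component meets its last column.\<close>

definition sweep_classes :: "nat set \<Rightarrow> nat set \<Rightarrow> (nat \<Rightarrow> nat \<Rightarrow> bool) \<Rightarrow> nat \<Rightarrow> (nat \<Rightarrow> nat) \<Rightarrow> bool" where
  "sweep_classes R C E s f \<longleftrightarrow> (\<forall>j\<in>C. f j \<in> C) \<and>
     (\<forall>i\<in>R. \<forall>j\<in>C. s \<le> i \<longrightarrow> E i j \<longrightarrow> E i (f j)) \<and>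
     (\<forall>i\<in>R. \<forall>j\<in>C. \<forall>j'\<in>C. i < s \<longrightarrow> E i j \<longrightarrow> E i j' \<longrightarrow> f j = f j')"

lemma sweep_classesD:
  assumes "sweep_classes R C E s f"
  shows "j \<in> C \<Longrightarrow> f j \<in> C"
    and "i \<in> R \<Longrightarrow> j \<in> C \<Longrightarrow> s \<le> i \<Longrightarrow> E i j \<Longrightarrow> E i (f j)"
    and "i \<in> R \<Longrightarrow> j \<in> C \<Longrightarrow> j' \<in> C \<Longrightarrow> i < s \<Longrightarrow> E i j \<Longrightarrow> E i j' \<Longrightarrow> f j = f j'"
proof -
  note c = assms[unfolded sweep_classes_def]
  show "j \<in> C \<Longrightarrow> f j \<in> C" by (rule c[THEN conjunct1, rule_format])
  show "i \<in> R \<Longrightarrow> j \<in> C \<Longrightarrow> s \<le> i \<Longrightarrow> E i j \<Longrightarrow> E i (f j)"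
    by (rule c[THEN conjunct2, THEN conjunct1, rule_format])
  show "i \<in> R \<Longrightarrow> j \<in> C \<Longrightarrow> j' \<in> C \<Longrightarrow> i < s \<Longrightarrow> E i j \<Longrightarrow> E i j' \<Longrightarrow> f j = f j'"
    by (rule c[THEN conjunct2, THEN conjunct2, rule_format])
qed

text \<open>If no such rectangle exists, the sweep passes through all rows with every class below a
  third of \<open>C\<close>. Grouping the final classes then gives a separation without deleting any
  row.\<close>

lemma gamma_free_sparse:
  assumes fin: "finite R" "finite C" and gf: "gamma_free R C E" and C: "3 < card C"
    and deg: "\<And>j. j \<in> C \<Longrightarrow> 2 * card {i \<in> R. E i j} \<le> card R"
  shows "\<exists>X Y. X \<subseteq> R \<and> Y \<subseteq> C \<and> card R \<le> 4 * card X \<and> card C \<le> 3 * card Y \<and>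
    (\<forall>i\<in>X. \<forall>j\<in>Y. \<not> E i j)" (is ?goal)
proof (rule ccontr)
  assume no: "\<not> ?goal"
  have sweep: "\<exists>f. sweep_classes R C E s f \<and> (\<forall>v. 3 * card {j \<in> C. f j = v} < card C)" for s
  proof (induction s)
    case 0
    \<comment> \<open>Before any row is added the classes are singletons, which are small because
      \<open>3 < card C\<close>.\<close>
    have "card {j \<in> C. id j = v} \<le> 1" for v
      by (rule card_le_one_nat) auto
    then have "3 * card {j \<in> C. id j = v} < card C" for v
      using C le_less_trans[of "3 * card {j \<in> C. id j = v}" 3 "card C"] by fastforce
    then show ?case by (intro exI[of _ id]) (auto simp: sweep_classes_def)
  next
    case (Suc s)
    then obtain f where f: "sweep_classes R C E s f" and f3: "\<And>v. 3 * card {j \<in> C. f j = v} < card C"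
      by blast
    note fC = sweep_classesD(1)[OF f] and f1 = sweep_classesD(2)[OF f] and f2 = sweep_classesD(3)[OF f]
    show ?case
    proof (cases "s \<in> R \<and> {j \<in> C. E s j} \<noteq> {}")
      case False
      then have "sweep_classes R C E (Suc s) f"
        unfolding sweep_classes_def
      proof (intro conjI ballI impI)
        fix i j j' assume "i \<in> R" "j \<in> C" "j' \<in> C" "i < Suc s" "E i j" "E i j'"
        moreover from this False have "i \<noteq> s" by blast
        ultimately show "f j = f j'" using f2[of i j j'] by simp
      qed (use fC f1 in auto)
      then show ?thesis using f3 by blast
    next
      case True
      define b where "b = Max {j \<in> C. E s j}"
      have "b \<in> {j \<in> C. E s j}"
        unfolding b_def using True fin by (intro Max_in) auto
      then have b: "b \<in> C" "E s b" by auto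
      have b_max: "j \<le> b" if "j \<in> C" "E s j" for j
        unfolding b_def using that fin by (intro Max_ge) auto
      \<comment> \<open>Merge all classes whose representative is hit by row \<open>s\<close>. By
        \<open>f1\<close> these include every class that row \<open>s\<close> meets.\<close>
      define g where "g j = (if E s (f j) then b else f j)" for j
      have g1: "E i (g j)" if "i \<in> R" "j \<in> C" "s < i" "E i j" for i j
      proof (cases "E s (f j)")
        case E: True
        have "E i (f j)" using f1 that by simp
        \<comment> \<open>The forbidden pattern enters here: row \<open>s\<close> has ones at
          \<open>f j\<close> and at its last one \<open>b\<close>, so a later row with a one at
          \<open>f j\<close> also has one at \<open>b\<close>.\<close>
        then have "E i b"
          using gamma_freeD[OF gf, of s i "f j" b] True that fC E b b_max by simp
        then show ?thesis using E unfolding g_def by simp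
      qed (use f1 that in \<open>simp add: g_def\<close>)
      have g2: "g j = g j'" if "i \<in> R" "j \<in> C" "j' \<in> C" "i < Suc s" "E i j" "E i j'" for i j j'
      proof (cases "i = s")
        case eq: True
        then have "E s (f j)" "E s (f j')" using f1 that by auto
        then show ?thesis unfolding g_def by simp
      qed (use f2[of i j j'] that in \<open>simp add: g_def\<close>)
      have "3 * card {j \<in> C. g j = v} < card C" for v
      proof (rule ccontr)
        assume big: "\<not> ?thesis"
        have "v = b"
        proof (rule ccontr)
          assume "v \<noteq> b"
          then have "{j \<in> C. g j = v} \<subseteq> {j \<in> C. f j = v}" unfolding g_def by auto
          then have "card {j \<in> C. g j = v} \<le> card {j \<in> C. f j = v}" using fin by (intro card_mono) auto
          then show False using f3[of v] big by simp
        qed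
        \<comment> \<open>Only the merged class can be too large. It consists of old, small classes,
          so some of them together form a balanced part.\<close>
        define V0 where "V0 = {v \<in> C. E s v}"
        have "{j \<in> C. g j = b} \<subseteq> {j \<in> C. f j \<in> V0}" unfolding g_def V0_def using fC b by (auto split: if_splits)
        then have "card {j \<in> C. g j = b} \<le> card {j \<in> C. f j \<in> V0}" using fin by (intro card_mono) auto
        then have "card C \<le> 3 * card {j \<in> C. f j \<in> V0}" using big \<open>v = b\<close> by simp
        then obtain V where V: "V \<subseteq> V0" "card C \<le> 3 * card {j \<in> C. f j \<in> V}"
          "3 * card {j \<in> C. f j \<in> V} \<le> 2 * card C"
          using balanced_fibres[of V0 C f "card C"] fin f3 C unfolding V0_def by auto
        have ?goal
        \<comment> \<open>Delete the rows adjacent to \<open>b\<close>, among them row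
          \<open>s\<close>. A remaining earlier row stays within one old class, and a remaining
          later row misses the chosen part altogether.\<close>
        proof (rule empty_rect_of_separation[OF fin _ V(2,3), of "{i \<in> R. E i b}"])
          show "2 * card {i \<in> R. E i b} \<le> card R" by (rule deg) fact
          fix i j j'
          assume i: "i \<in> R - {i \<in> R. E i b}" and j: "j \<in> {j \<in> C. f j \<in> V}" "E i j"
            and j': "j' \<in> C - {j \<in> C. f j \<in> V}" "E i j'"
          have "i \<noteq> s" using i b by auto
          then have "i < s \<or> s < i" by auto
          then consider "i < s" | "s < i" by blast
          then show False
          proof cases
            case 1
            then have "f j = f j'" using f2 i j j' by blast
            then show False using j j' by simp
          next
            case 2
            then have "E i (g j)" using g1 i j by blast
            moreover have "g j = b" using j V(1) unfolding g_def V0_def by auto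
            ultimately show False using i by simp
          qed
        qed auto
        then show False using no by blast
      qed
      moreover have "g j \<in> C" if "j \<in> C" for j using that b fC unfolding g_def by simp
      then have "sweep_classes R C E (Suc s) g"
        unfolding sweep_classes_def
      proof (intro conjI ballI impI)
        fix i j assume "i \<in> R" "j \<in> C" "Suc s \<le> i" "E i j"
        then show "E i (g j)" using g1 by simp
      next
        fix i j j' assume "i \<in> R" "j \<in> C" "j' \<in> C" "i < Suc s" "E i j" "E i j'"
        then show "g j = g j'" by (rule g2)
      qed
      ultimately show ?thesis by blast
    qed
  qed
  obtain s where s: "\<And>i. i \<in> R \<Longrightarrow> i < s"
    using fin(1) by (metis finite_nat_set_iff_bounded)
  obtain f where f: "sweep_classes R C E s f" and f3: "\<And>v. 3 * card {j \<in> C. f j = v} < card C"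
    using sweep[of s] by blast
  note fC = sweep_classesD(1)[OF f] and f2 = sweep_classesD(3)[OF f]
  have "{j \<in> C. f j \<in> C} = C" using fC by auto
  then obtain V where V: "card C \<le> 3 * card {j \<in> C. f j \<in> V}"
    "3 * card {j \<in> C. f j \<in> V} \<le> 2 * card C"
    using balanced_fibres[of C C f "card C"] fin f3 C by auto
  have ?goal
  \<comment> \<open>As \<open>s\<close> exceeds all rows, every row stays within one class.\<close>
  proof (rule empty_rect_of_separation[OF fin _ V, of "{}"])
    fix i j j'
    assume i: "i \<in> R - {}" and j: "j \<in> {j \<in> C. f j \<in> V}" "E i j"
      and j': "j' \<in> C - {j \<in> C. f j \<in> V}" "E i j'"
    then have "f j = f j'" using f2[of i j j'] s by simp
    then show False using j j' by simp
  qed auto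
  then show False using no by blast
qed

text \<open>\<open>T\<close> marks the ones with many ones below them, which make up a quarter of
  every column. By averaging, some row contains many marked ones, and its leftmost one spans the
  rectangle.\<close>

lemma gamma_free_dense:
  assumes fin: "finite R" "finite C" and gf: "gamma_free R C E"
    and deg: "\<And>j. j \<in> C \<Longrightarrow> card R < 2 * card {i \<in> R. E i j}"
  shows "\<exists>X Y. X \<subseteq> R \<and> Y \<subseteq> C \<and> card R \<le> 4 * card X \<and> card C \<le> 4 * card Y \<and>
    (\<forall>i\<in>X. \<forall>j\<in>Y. E i j)"
proof (cases "C = {}")
  case True
  then show ?thesis by (intro exI[of _ R] exI[of _ "{}"]) auto
next
  case False
  define below where "below i j = {i' \<in> R. i \<le> i' \<and> E i' j}" for i j
  define T where "T i j \<longleftrightarrow> E i j \<and> card R \<le> 4 * card (below i j)" for i j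
  have T: "card R \<le> 4 * card {i \<in> R. T i j}" if "j \<in> C" for j
  proof -
    \<comment> \<open>All of \<open>B\<close> lies weakly below its topmost member, which is
      unmarked; hence \<open>B\<close> has at most a quarter of the rows.\<close>
    define B where "B = {i \<in> R. E i j \<and> \<not> T i j}"
    have B: "4 * card B \<le> card R"
    proof (cases "B = {}")
      case False
      define m where "m = Min B"
      have finB: "finite B" using fin unfolding B_def by simp
      have m: "m \<in> B" unfolding m_def using finB False by (rule Min_in)
      have "B \<subseteq> below m j" using finB unfolding m_def below_def by (auto simp: B_def)
      then have "card B \<le> card (below m j)" using fin by (intro card_mono) (auto simp: below_def)
      then show ?thesis using m unfolding B_def T_def by auto
    qed simp
    have "{i \<in> R. E i j} = {i \<in> R. T i j} \<union> B" unfolding B_def T_def by auto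
    then have "card {i \<in> R. E i j} \<le> card {i \<in> R. T i j} + card B" by (rule card_le_of_eq_Un)
    then show ?thesis using B deg[OF that] by linarith
  qed
  have "R \<noteq> {}" using False deg by fastforce
  \<comment> \<open>Double counting of the marked cells by rows and by columns.\<close>
  have "\<exists>i\<in>R. card C \<le> 4 * card {j \<in> C. T i j}"
  proof (rule ccontr)
    assume "\<not> ?thesis"
    then have "(\<Sum>i\<in>R. 4 * card {j \<in> C. T i j}) < (\<Sum>i\<in>R. card C)"
      using fin \<open>R \<noteq> {}\<close> by (intro sum_strict_mono) auto
    moreover have "(\<Sum>i\<in>R. card {j \<in> C. T i j}) = (\<Sum>j\<in>C. card {i \<in> R. T i j})"
      using fin by (intro sum_multicount_gen) auto
    moreover have "(\<Sum>j\<in>C. card R) \<le> (\<Sum>j\<in>C. 4 * card {i \<in> R. T i j})"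
      by (intro sum_mono T)
    ultimately show False by (simp add: mult.commute flip: sum_distrib_left)
  qed
  then obtain i where i: "i \<in> R" "card C \<le> 4 * card {j \<in> C. T i j}" by blast
  define Y where "Y = {j \<in> C. T i j}"
  have "card Y \<noteq> 0" using i(2) False fin unfolding Y_def by (metis card_0_eq le_zero_eq mult_0_right)
  then have Y: "finite Y" "Y \<noteq> {}" by (auto intro: card_ge_0_finite)
  define m where "m = Min Y"
  have m: "m \<in> Y" "\<And>j. j \<in> Y \<Longrightarrow> m \<le> j" unfolding m_def using Y by auto
  have "\<forall>i'\<in>below i m. \<forall>j\<in>Y. E i' j"
    using gamma_freeD[OF gf i(1)] m unfolding below_def Y_def T_def by blast
  moreover have "below i m \<subseteq> R" "Y \<subseteq> C" unfolding below_def Y_def by auto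
  moreover have "card R \<le> 4 * card (below i m)" using m(1) unfolding Y_def T_def by blast
  moreover have "card C \<le> 4 * card Y" using i(2) unfolding Y_def .
  ultimately show ?thesis by blast
qed

lemma forces_gamma: "forces_large_rect True True True False"
  unfolding forces_large_rect_def
proof (intro allI impI)
  fix n E assume av: "avoids n E True True True False"
  have gf: "gamma_free {..<n} C E" if "C \<subseteq> {..<n}" for C
    using that av unfolding gamma_free_def avoids_def by blast
  show "large_rect n E"
  proof (cases "n \<le> 32")
    case True
    then show ?thesis by (rule large_rect_small)
  next
    case n: False
    define S where "S = {j. j < n \<and> 2 * card {i \<in> {..<n}. E i j} \<le> n}"
    define D where "D = {j. j < n \<and> n < 2 * card {i \<in> {..<n}. E i j}}"
    have sub: "S \<subseteq> {..<n}" "D \<subseteq> {..<n}" unfolding S_def D_def by auto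
    have fin: "finite S" "finite D" using sub by (auto intro: finite_subset)
    have "{..<n} = S \<union> D" unfolding S_def D_def by auto
    then have "card {..<n} \<le> card S + card D" by (rule card_le_of_eq_Un)
    then have "n \<le> 2 * card S \<or> n \<le> 2 * card D" by auto
    then consider "n \<le> 2 * card S" | "n \<le> 2 * card D" by blast
    then show ?thesis
    proof cases
      case 1
      \<comment> \<open>The condition \<open>3 < card S\<close> follows from \<open>n > 32\<close>,
        as \<open>S\<close> contains half of the columns.\<close>
      have "\<exists>X Y. X \<subseteq> {..<n} \<and> Y \<subseteq> S \<and> card {..<n} \<le> 4 * card X \<and> card S \<le> 3 * card Y \<and>
          (\<forall>i\<in>X. \<forall>j\<in>Y. \<not> E i j)"
        using 1 n fin sub by (intro gamma_free_sparse gf) (auto simp: S_def)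
      then obtain X Y where "X \<subseteq> {..<n}" "Y \<subseteq> S" "n \<le> 4 * card X" "card S \<le> 3 * card Y"
          "\<forall>i\<in>X. \<forall>j\<in>Y. \<not> E i j" by auto
      then show ?thesis using 1 sub by (intro large_rectI[of X _ Y _ False]) auto
    next
      case 2
      have "\<exists>X Y. X \<subseteq> {..<n} \<and> Y \<subseteq> D \<and> card {..<n} \<le> 4 * card X \<and> card D \<le> 4 * card Y \<and>
          (\<forall>i\<in>X. \<forall>j\<in>Y. E i j)"
        using 2 n fin sub by (intro gamma_free_dense gf) (auto simp: D_def)
      then obtain X Y where "X \<subseteq> {..<n}" "Y \<subseteq> D" "n \<le> 4 * card X" "card D \<le> 4 * card Y"
          "\<forall>i\<in>X. \<forall>j\<in>Y. E i j" by auto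
      then show ?thesis using 2 sub by (intro large_rectI[of X _ Y _ True]) auto
    qed
  qed
qed

subsection \<open>All patterns\<close>

text \<open>The 14 inhomogeneous patterns are the four positions of the odd entry in either colour
  (\<open>g\<close> and complements), two with constant rows (\<open>r\<close>), two with constant
  columns (\<open>c\<close>) and two diagonals (\<open>d\<close>).\<close>

lemma forces_large_rect:
  assumes "\<not> (p = q \<and> q = r \<and> r = s)"
  shows "forces_large_rect p q r s"
proof -
  note transpose = forces_large_rect_transpose and flip = forces_large_rect_flip_rows
    and complement = forces_large_rect_complement
  note g = forces_gamma flip[OF forces_gamma] transpose[OF flip[OF forces_gamma]]
    flip[OF transpose[OF flip[OF forces_gamma]]]
  note r = forces_constant_rows flip[OF forces_constant_rows]
  note c = r[THEN transpose]
  note d = forces_diagonal flip[OF forces_diagonal]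
  from g g[THEN complement] r c d show ?thesis using assms
    by (cases p; cases q; cases r; cases s) simp_all
qed

section \<open>Transfer from Boolean arrays to matrices\<close>

lemma contains_mat_2I:
  assumes "P \<in> carrier_mat 2 2" "A \<in> carrier_mat n n" "i < i'" "i' < n" "j < j'" "j' < n"
    and "A $$ (i, j) = P $$ (0, 0)" "A $$ (i, j') = P $$ (0, 1)"
      "A $$ (i', j) = P $$ (1, 0)" "A $$ (i', j') = P $$ (1, 1)"
  shows "contains_mat A P"
proof -
  define r where "r a = (if a = 0 then i else i')" for a :: nat
  define s where "s a = (if a = 0 then j else j')" for a :: nat
  have two: "{..<2} = {0, 1 :: nat}" by auto
  show ?thesis
    unfolding contains_mat_def
    using assms
    by (intro exI[of _ r] exI[of _ s])
      (auto simp: r_def s_def two strict_mono_on_def less_2_cases_iff)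
qed

lemma homogeneous_submatrixI:
  assumes "\<And>i j. i \<in> X \<Longrightarrow> j \<in> Y \<Longrightarrow> i < dim_row A \<Longrightarrow> j < dim_col A \<Longrightarrow> A $$ (i, j) = v"
  shows "homogeneous (submatrix A X Y)"
proof -
  have "x = v" if x: "x \<in> elements_mat (submatrix A X Y)" for x
  proof -
    from elements_matD[OF x] obtain i j
      where ij: "i < card {i. i < dim_row A \<and> i \<in> X}" "j < card {j. j < dim_col A \<and> j \<in> Y}"
        "x = submatrix A X Y $$ (i, j)"
      by (auto simp: dim_submatrix)
    have "pick X i < dim_row A" "pick Y j < dim_col A" using ij pick_le by auto
    \<comment> \<open>\<open>S\<close> may reach beyond the index range or be infinite, so
      \<open>pick\<close> is first reduced to the part of \<open>S\<close> below
      \<open>d\<close>.\<close>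
    moreover have "pick S m \<in> S" if "m < card {a. a < d \<and> a \<in> S}" for S m d
      using pick_reduce_set[OF that] pick_in_set_le[OF that] by simp
    then have "pick X i \<in> X" "pick Y j \<in> Y" using ij(1,2) by blast+
    ultimately show ?thesis using ij assms by (simp add: submatrix_index)
  qed
  then show ?thesis unfolding homogeneous_def by blast
qed

theorem theorem1p1:
  fixes P :: "nat mat"
  assumes "P \<in> carrier_mat 2 2"
    and "zero_one_mat P"
    and "\<not> homogeneous P"
  shows "\<exists>c::real. c > 0 \<and>
    (\<forall>n::nat. \<forall>A \<in> carrier_mat n n. zero_one_mat A \<and> mat_free P A \<longrightarrow>
      (\<exists>X Y. X \<subseteq> {..<n} \<and> Y \<subseteq> {..<n} \<and>
        card X = nat \<lceil>c * real n\<rceil> \<and> card Y = nat \<lceil>c * real n\<rceil> \<and>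
        homogeneous (submatrix A X Y)))"
proof (intro exI[of _ "1 / 32"] conjI allI ballI impI)
  fix n :: nat and A :: "nat mat"
  assume A: "A \<in> carrier_mat n n" and *: "zero_one_mat A \<and> mat_free P A"
  define E where "E i j \<longleftrightarrow> A $$ (i, j) = 1" for i j
  define p where "p a b \<longleftrightarrow> P $$ (a, b) = 1" for a b
  have P01: "P $$ (a, b) \<in> {0, 1}" if "a < 2" "b < 2" for a b
    using assms(2) elements_matI[OF assms(1) that refl] unfolding zero_one_mat_def by auto
  have A01: "A $$ (i, j) \<in> {0, 1}" if "i < n" "j < n" for i j
    using * elements_matI[OF A that refl] unfolding zero_one_mat_def by auto
  have entry_eq: "A $$ (i, j) = P $$ (a, b)" if "E i j = p a b" "i < n" "j < n" "a < 2" "b < 2"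
    for i j a b
    using that P01[of a b] A01[of i j] unfolding E_def p_def by auto
  have "\<not> (p 0 0 = p 0 1 \<and> p 0 1 = p 1 0 \<and> p 1 0 = p 1 1)"
  proof
    assume eq: "p 0 0 = p 0 1 \<and> p 0 1 = p 1 0 \<and> p 1 0 = p 1 1"
    have "P $$ (a, b) = P $$ (0, 0)" if "a < 2" "b < 2" for a b
    proof -
      have "p a b = p 0 0" using that eq by (auto simp: less_2_cases_iff)
      then show ?thesis using P01[OF that] P01[of 0 0] unfolding p_def by auto
    qed
    then have "x = P $$ (0, 0)" if "x \<in> elements_mat P" for x
    proof -
      from elements_matD[OF that] obtain a b where "a < 2" "b < 2" "x = P $$ (a, b)"
        using assms(1) by auto
      then show ?thesis using \<open>\<And>a b. a < 2 \<Longrightarrow> b < 2 \<Longrightarrow> P $$ (a, b) = P $$ (0, 0)\<close>[of a b] by simp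
    qed
    then have "homogeneous P" unfolding homogeneous_def by metis
    then show False using assms(3) by blast
  qed
  moreover have "avoids n E (p 0 0) (p 0 1) (p 1 0) (p 1 1)"
    unfolding avoids_def
  proof (intro allI impI notI)
    fix i i' j j' assume "i < i'" "i' < n" "j < j'" "j' < n"
      and "E i j = p 0 0 \<and> E i j' = p 0 1 \<and> E i' j = p 1 0 \<and> E i' j' = p 1 1"
    then have "contains_mat A P"
      by (intro contains_mat_2I[OF assms(1) A, of i i' j j'] entry_eq) auto
    then show False using * by blast
  qed
  ultimately have "large_rect n E"
    using forces_large_rect unfolding forces_large_rect_def by blast
  then obtain X Y v where XY: "X \<subseteq> {..<n}" "Y \<subseteq> {..<n}" "n \<le> 32 * card X" "n \<le> 32 * card Y"
    "\<forall>i\<in>X. \<forall>j\<in>Y. E i j = v"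
    unfolding large_rect_def constant_on_rect_def by blast
  \<comment> \<open>The sizes must be exact. Being integers of at least \<open>n / 32\<close>, both
    cardinalities reach the ceiling, and the rectangle can be trimmed to it.\<close>
  define m where "m = nat \<lceil>1 / 32 * real n\<rceil>"
  have "m \<le> card X" "m \<le> card Y"
    using XY(3,4) unfolding m_def by (simp_all add: nat_le_iff ceiling_le_iff)
  obtain X' where X': "X' \<subseteq> X" "card X' = m" by (rule obtain_subset_with_card_n[OF \<open>m \<le> card X\<close>])
  obtain Y' where Y': "Y' \<subseteq> Y" "card Y' = m" by (rule obtain_subset_with_card_n[OF \<open>m \<le> card Y\<close>])
  have "homogeneous (submatrix A X' Y')"
  proof (rule homogeneous_submatrixI)
    fix i j assume ij: "i \<in> X'" "j \<in> Y'"
    then have "i < n" "j < n" using X' Y' XY(1,2) by auto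
    with A01 have "A $$ (i, j) \<in> {0, 1}" by blast
    moreover have "E i j = v" using ij X' Y' XY(5) by blast
    ultimately show "A $$ (i, j) = (if v then 1 else 0)"
      unfolding E_def by auto
  qed
  then show "\<exists>X Y. X \<subseteq> {..<n} \<and> Y \<subseteq> {..<n} \<and> card X = nat \<lceil>1 / 32 * real n\<rceil> \<and>
      card Y = nat \<lceil>1 / 32 * real n\<rceil> \<and> homogeneous (submatrix A X Y)"
    using X' Y' XY(1,2) unfolding m_def by (intro exI[of _ X'] exI[of _ Y']) auto
qed simp

end
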